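(* Let $n \geq 1$, let $d_0 \geq d_1 \geq \cdots \geq d_n \geq 2$ be integers, and set $t = d_0 + \cdots + d_n - (n+1)$. Let $K$ be an infinite field of characteristic $p$, where $p$ is a positive prime, let $R = K[x_0,\ldots,x_n]$, and let $I_{\underline{d}} = (x_0^{d_0}, \ldots, x_n^{d_n})$. Then: (i) If $\max\{d_1, 2d_0 - t\} \leq p \leq d_0$, or $d_0 \leq p^m \leq t$ for some positive integer $m$, then $R/I_{\underline{d}}$ fails to have the strong Lefschetz property. (ii) If $p > t$, then $R/I_{\underline{d}}$ has the strong Lefschetz property.
   Context: $R$ is standard graded and $[A]_d$ denotes the degree $d$ component of a graded algebra $A$. An artinian standard graded $K$-algebra $A$ has the strong Lefschetz property if there exists a linear form $\ell \in A$ such that for all integers $d$ and all $k \geq 1$ the multiplication map $\times \ell^k : [A]_d \rightarrow [A]_{d+k}$ has maximal rank (i.e. is injective or surjective). The number $t$ is the socle degree of $R/I_{\underline{d}}$. *)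

theory Defs
  imports
    "HOL-Library.Poly_Mapping"
    "HOL-Computational_Algebra.Primes"
    "HOL-Algebra.QuotRing"
begin

text \<open>
  Exponent vectors are finitely supported maps from variable indices to \<open>nat\<close>, and polynomials
  are finitely supported maps from exponent vectors to the field. The convolution product of
  \<open>HOL-Library.Poly_Mapping\<close> is then polynomial multiplication.
\<close>

type_synonym 'k mpoly = "(nat \<Rightarrow>\<^sub>0 nat) \<Rightarrow>\<^sub>0 'k"

definition mon_degree :: "(nat \<Rightarrow>\<^sub>0 nat) \<Rightarrow> nat" where
  "mon_degree m = (\<Sum>i\<in>Poly_Mapping.keys m. Poly_Mapping.lookup m i)"

definition variable_poly :: "nat \<Rightarrow> 'k::field mpoly" where
  "variable_poly i = Poly_Mapping.single (Poly_Mapping.single i 1) 1"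

text \<open>
  The ring \<open>K[x\<^sub>0, \<dots>, x\<^sub>n]\<close> (with \<open>n + 1\<close> variables) over the field given by the type \<open>'k\<close>:
  the polynomials in which only variables of index at most \<open>n\<close> occur.
\<close>

definition poly_ring :: "nat \<Rightarrow> 'k::field mpoly ring" where
  "poly_ring n =
    \<lparr>carrier = {f. \<forall>m\<in>Poly_Mapping.keys f. Poly_Mapping.keys m \<subseteq> {..n}},
     mult = (*), one = 1, zero = 0, add = (+)\<rparr>"

text \<open>
  Degrees range over all integers. The zero polynomial is homogeneous of every degree, so
  components of negative degree consist of zero only.
\<close>

definition poly_component :: "nat \<Rightarrow> int \<Rightarrow> 'k::field mpoly set" where
  "poly_component n e =
    {f \<in> carrier (poly_ring n). \<forall>m\<in>Poly_Mapping.keys f. int (mon_degree m) = e}"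

definition power_ideal :: "nat \<Rightarrow> (nat \<Rightarrow> nat) \<Rightarrow> 'k::field mpoly set" where
  "power_ideal n d =
    Idl\<^bsub>poly_ring n\<^esub> {variable_poly i [^]\<^bsub>poly_ring n\<^esub> d i | i. i \<le> n}"

text \<open>
  For a homogeneous ideal \<open>I\<close> the degree \<open>e\<close> component of the quotient is the image of
  the degree \<open>e\<close> component of the polynomial ring.
\<close>

definition quotient_component :: "nat \<Rightarrow> 'k::field mpoly set \<Rightarrow> int \<Rightarrow> 'k mpoly set set" where
  "quotient_component n I e = (\<lambda>f. I +>\<^bsub>poly_ring n\<^esub> f) ` poly_component n e"

text \<open>
  A graded algebra is given by its underlying ring \<open>A\<close> and its family \<open>gr\<close> of homogeneous
  components. The notion is meant for artinian standard graded algebras.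
\<close>

definition strong_lefschetz_property :: "('a, 'b) ring_scheme \<Rightarrow> (int \<Rightarrow> 'a set) \<Rightarrow> bool" where
  "strong_lefschetz_property A gr \<longleftrightarrow>
    (\<exists>l\<in>gr 1. \<forall>(e::int) (k::nat). 1 \<le> k \<longrightarrow>
      inj_on (\<lambda>a. l [^]\<^bsub>A\<^esub> k \<otimes>\<^bsub>A\<^esub> a) (gr e) \<or>
      (\<lambda>a. l [^]\<^bsub>A\<^esub> k \<otimes>\<^bsub>A\<^esub> a) ` gr e = gr (e + int k))"

end

theory Submission
  imports Defs
begin

text \<open>
  (i) For \<open>q\<close> a power of \<open>p\<close>, the \<open>q\<close>-th power of a linear form is a combination of the
  \<open>x\<^sub>i\<^sup>q\<close>. If \<open>d\<^sub>1 \<le> q\<close>, only \<open>x\<^sub>0\<^sup>q\<close> survives modulo the ideal, and multiplication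
  by it is neither injective nor surjective in a suitable degree.

  (ii) Let \<open>E\<close> be multiplication by \<open>x\<^sub>0 + \<dots> + x\<^sub>n\<close> and let \<open>F\<close> be the sum of the
  differential operators \<open>(d\<^sub>i - 1) \<partial>\<^sub>i - x\<^sub>i \<partial>\<^sub>i\<^sup>2\<close>. Already on the polynomial ring
  \<open>E F - F E\<close> is multiplication by \<open>2 e - t\<close> in degree \<open>e\<close>, and \<open>F\<close> preserves the ideal.
  The hard Lefschetz argument for \<open>sl\<^sub>2\<close> divides only by products of integers in
  \<open>{1..t}\<close>, which are invertible when \<open>p > t\<close>.
\<close>

section \<open>Maximal rank from an sl2 action\<close>

text \<open>Respecting differences forces linearity over the integers, and this supplies all the
  linearity of \<open>E\<close> and \<open>F\<close> used in \<open>sl2_pair\<close>.\<close>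

lemma additive_of_int_mult:
  fixes f :: "'a::ring_1 \<Rightarrow> 'b::ring_1"
  assumes "\<And>x y. f (x - y) = f x - f y"
  shows "f (of_int c * x) = of_int c * f x"
proof -
  have zero: "f 0 = 0"
    using assms[of 0 0] by simp
  have minus: "f (- x) = - f x" for x
    using assms[of 0 x] by (simp add: zero)
  have add: "f (x + y) = f x + f y" for x y
    using assms[of x "- y"] by (simp add: minus)
  show ?thesis
    by (induction c rule: int_induct[where k = 0])
      (simp_all add: zero add assms algebra_simps)
qed

lemma diff_closed_of_int_mult:
  fixes S :: "'a::ring_1 set"
  assumes "0 \<in> S" "\<And>x y. x \<in> S \<Longrightarrow> y \<in> S \<Longrightarrow> x - y \<in> S" "x \<in> S"
  shows "of_int c * x \<in> S"
proof -
  have minus: "- y \<in> S" if "y \<in> S" for y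
    using assms(2)[OF assms(1) that] by simp
  have add: "y + z \<in> S" if "y \<in> S" "z \<in> S" for y z
    using assms(2)[of y "- z"] minus that by simp
  show ?thesis
  proof (induction c rule: int_induct[where k = 0])
    case base
    then show ?case using assms(1) by simp
  next
    case (step1 i)
    then show ?case using add[OF step1(2) assms(3)] by (simp add: algebra_simps)
  next
    case (step2 i)
    then show ?case using assms(2)[OF step2(2) assms(3)] by (simp add: algebra_simps)
  qed
qed

text \<open>
  The axioms describe a weight-graded representation of \<open>sl\<^sub>2\<close> on the quotient of
  \<open>\<Union>e. V e\<close> by \<open>I\<close>, with degree \<open>e\<close> of weight \<open>2 * e - t\<close>.
  All scalars that occur are integers, so no base field is needed.
\<close>

locale sl2_pair =
  fixes V :: "int \<Rightarrow> 'a::ring_1 set" and I :: "'a set" and E F :: "'a \<Rightarrow> 'a" and t :: int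
  assumes V_zero: "0 \<in> V e"
    and V_diff: "x \<in> V e \<Longrightarrow> y \<in> V e \<Longrightarrow> x - y \<in> V e"
    and I_zero: "0 \<in> I"
    and I_diff: "x \<in> I \<Longrightarrow> y \<in> I \<Longrightarrow> x - y \<in> I"
    and E_diff: "E (x - y) = E x - E y"
    and F_diff: "F (x - y) = F x - F y"
    and E_V: "x \<in> V e \<Longrightarrow> E x \<in> V (e + 1)"
    and F_V: "x \<in> V e \<Longrightarrow> F x \<in> V (e - 1)"
    and E_I: "x \<in> I \<Longrightarrow> E x \<in> I"
    and F_I: "x \<in> I \<Longrightarrow> F x \<in> I"
    and commutator: "x \<in> V e \<Longrightarrow> E (F x) - F (E x) = of_int (2 * e - t) * x"
    and V_outside: "e < 0 \<or> t < e \<Longrightarrow> V e \<subseteq> I"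
    and invertible: "0 < c \<Longrightarrow> c \<le> t \<Longrightarrow> \<exists>b. of_int b * of_int c = (1::'a)"
begin

text \<open>Reflecting degrees by \<open>e\<close> to \<open>t - e\<close> negates the weights,
  which is the sign change caused by exchanging raising and lowering. Facts on powers of
  \<open>E\<close> thereby transfer to powers of \<open>F\<close>.\<close>

lemma swap: "sl2_pair (\<lambda>e. V (t - e)) I F E t"
proof
  fix x e
  assume "x \<in> V (t - e)"
  then show "F (E x) - E (F x) = of_int (2 * e - t) * x"
    using commutator[of x "t - e"] by (simp add: algebra_simps)
  show "F x \<in> V (t - (e + 1))" "E x \<in> V (t - (e - 1))"
    using E_V F_V \<open>x \<in> V (t - e)\<close> by (fastforce simp: algebra_simps)+
next
  fix e :: int
  assume "e < 0 \<or> t < e"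
  then show "V (t - e) \<subseteq> I"
    using V_outside[of "t - e"] by auto
qed (use V_zero V_diff I_zero I_diff E_diff F_diff E_I F_I invertible in auto)

lemma I_minus: "x \<in> I \<Longrightarrow> - x \<in> I"
  using I_diff[OF I_zero] by simp

lemma I_add: "x \<in> I \<Longrightarrow> y \<in> I \<Longrightarrow> x + y \<in> I"
  using I_diff[of x "- y"] I_minus by simp

lemma V_add:
  assumes "x \<in> V e" "y \<in> V e"
  shows "x + y \<in> V e"
  using V_diff[OF assms(1) V_diff[OF V_zero assms(2)]] by simp

lemma I_of_int: "x \<in> I \<Longrightarrow> of_int c * x \<in> I"
  by (rule diff_closed_of_int_mult[OF I_zero I_diff])

lemma V_of_int: "x \<in> V e \<Longrightarrow> of_int c * x \<in> V e"
  by (rule diff_closed_of_int_mult[OF V_zero V_diff])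

lemma E_of_int: "E (of_int c * x) = of_int c * E x"
  by (rule additive_of_int_mult[OF E_diff])

lemma E_zero: "E 0 = 0"
  using E_diff[of 0 0] by simp

lemma E_add: "E (x + y) = E x + E y"
proof -
  have "E (x + y) = E x - E (0 - y)"
    by (simp flip: E_diff)
  also have "\<dots> = E x + E y"
    by (simp only: E_diff E_zero) simp
  finally show ?thesis .
qed

lemma Epow_diff: "(E ^^ k) (x - y) = (E ^^ k) x - (E ^^ k) y"
  by (induction k) (simp_all add: E_diff)

lemma Epow_add: "(E ^^ k) (x + y) = (E ^^ k) x + (E ^^ k) y"
  by (induction k) (simp_all add: E_add)

lemma Epow_of_int: "(E ^^ k) (of_int c * x) = of_int c * (E ^^ k) x"
  by (induction k) (simp_all add: E_of_int)

lemma Epow_V: "x \<in> V e \<Longrightarrow> (E ^^ k) x \<in> V (e + int k)"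
proof (induction k)
  case (Suc k)
  then show ?case using E_V[of "(E ^^ k) x" "e + int k"] by (simp add: algebra_simps)
qed simp

lemma Epow_I: "x \<in> I \<Longrightarrow> (E ^^ k) x \<in> I"
  by (induction k) (simp_all add: E_I)

text \<open>Moving \<open>F\<close> past the \<open>k + 1\<close> factors \<open>E\<close> one at a
  time collects the weights \<open>2 * (e + j) - t\<close> for \<open>j = 0, ..., k\<close>, whose
  sum is the coefficient.\<close>

lemma F_Epow:
  assumes "x \<in> V e"
  shows "F ((E ^^ Suc k) x) =
    (E ^^ Suc k) (F x) - of_int ((int k + 1) * (2 * e - t + int k)) * (E ^^ k) x"
proof (induction k)
  case 0
  then show ?case using commutator[OF assms] by (simp add: algebra_simps)
next
  case (Suc k)
  let ?y = "(E ^^ Suc k) x"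
  let ?c = "(int k + 1) * (2 * e - t + int k)"
  have "F (E ?y) = E (F ?y) - of_int (2 * (e + int (Suc k)) - t) * ?y"
    using commutator[OF Epow_V[OF assms, of "Suc k"]] by (simp add: algebra_simps)
  also have "E (F ?y) = (E ^^ Suc (Suc k)) (F x) - of_int ?c * ?y"
    unfolding Suc.IH by (simp only: E_diff E_of_int) simp
  also have "(E ^^ Suc (Suc k)) (F x) - of_int ?c * ?y - of_int (2 * (e + int (Suc k)) - t) * ?y =
      (E ^^ Suc (Suc k)) (F x) - of_int (?c + (2 * (e + int (Suc k)) - t)) * ?y"
    by (simp only: of_int_add distrib_right diff_diff_eq)
  also have "?c + (2 * (e + int (Suc k)) - t) =
      (int (Suc k) + 1) * (2 * e - t + int (Suc k))"
    by (simp add: algebra_simps)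
  finally show ?case by simp
qed

text \<open>The product may exceed \<open>t\<close>, so the two factors are inverted
  separately.\<close>

lemma invertible2:
  assumes "0 < a" "a \<le> t" "0 < b" "b \<le> t"
  obtains c where "of_int c * of_int (a * b) = (1::'a)"
proof -
  obtain a' b' where *: "of_int a' * of_int a = (1::'a)" "of_int b' * of_int b = (1::'a)"
    using invertible assms by meson
  have "of_int (b' * a') * of_int (a * b) = of_int b' * (of_int a' * of_int a) * (of_int b::'a)"
    by (simp add: mult.assoc)
  also have "\<dots> = 1"
    by (simp add: *)
  finally show thesis by (rule that)
qed

lemma I_cancel:
  assumes "0 < a" "a \<le> t" "0 < b" "b \<le> t" "of_int (a * b) * x \<in> I"
  shows "x \<in> I"
proof -
  obtain c where c: "of_int c * of_int (a * b) = (1::'a)"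
    using invertible2 assms(1-4) by blast
  have "of_int c * (of_int (a * b) * x) \<in> I"
    by (rule I_of_int[OF assms(5)])
  then show ?thesis
    by (simp only: mult.assoc[symmetric] c mult_1_left)
qed

text \<open>
  By induction on \<open>e\<close>, \<open>E\<^sup>m v \<in> I\<close> forces \<open>F v \<in> I\<close>, because
  \<open>F\<close> commutes with \<open>E\<^sup>m\<^sup>+\<^sup>1\<close> on weight \<open>- m\<close>. Applying
  \<open>F\<close> to \<open>E\<^sup>k\<^sup>+\<^sup>1 v\<close> then lowers \<open>k\<close> from \<open>m\<close> down to \<open>0\<close>.
\<close>

lemma Epow_inj:
  assumes "2 * e + int m = t" "v \<in> V e" "(E ^^ m) v \<in> I"
  shows "v \<in> I"
  using assms
proof (induction "nat (e + 1)" arbitrary: e m v)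
  \<comment> \<open>The measure \<open>nat (e + 1)\<close> is zero exactly in negative degrees, and
    these lie in \<open>I\<close>.\<close>
  case 0
  then show ?case using V_outside[of e] by auto
next
  case (Suc a)
  have "0 \<le> e"
    using Suc.hyps(2) by linarith
  have "2 * e - t + int m = 0"
    using Suc.prems(1) by simp
  then have "F ((E ^^ Suc m) v) = (E ^^ Suc m) (F v)"
    using F_Epow[OF Suc.prems(2), of m] by simp
  moreover have "(E ^^ Suc m) v \<in> I"
    using E_I[OF Suc.prems(3)] by simp
  ultimately have "(E ^^ Suc m) (F v) \<in> I"
    using F_I by metis
  \<comment> \<open>The induction hypothesis in degree \<open>e - 1\<close> concerns the exponent
    \<open>m + 2\<close>, hence one more factor \<open>E\<close>.\<close>
  then have "(E ^^ Suc (Suc m)) (F v) \<in> I"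
    using E_I by simp
  then have Fv: "F v \<in> I"
    using Suc.hyps(1)[of "e - 1" "Suc (Suc m)" "F v"] Suc.hyps(2) Suc.prems(1)
      F_V[OF Suc.prems(2)] by simp
  have "(E ^^ 0) v \<in> I"
  proof (rule inc_induct[of 0 m "\<lambda>k. (E ^^ k) v \<in> I"])
    fix k
    assume k: "k < m" and IH: "(E ^^ Suc k) v \<in> I"
    \<comment> \<open>Since \<open>m = t - 2 * e\<close> with \<open>0 <= e\<close>, both
      \<open>k + 1\<close> and \<open>m - k\<close> lie between 1 and \<open>t\<close> for
      \<open>k < m\<close>, so their product can be cancelled.\<close>
    have coeff: "(int k + 1) * (2 * e - t + int k) = - ((int k + 1) * (int m - int k))"
      by (simp add: algebra_simps flip: Suc.prems(1))
    have "F ((E ^^ Suc k) v) =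
        (E ^^ Suc k) (F v) + of_int ((int k + 1) * (int m - int k)) * (E ^^ k) v"
      unfolding F_Epow[OF Suc.prems(2)] coeff of_int_minus by simp
    then have "of_int ((int k + 1) * (int m - int k)) * (E ^^ k) v =
        F ((E ^^ Suc k) v) - (E ^^ Suc k) (F v)"
      by simp
    also have "\<dots> \<in> I"
      by (intro I_diff F_I IH Epow_I Fv)
    finally show "(E ^^ k) v \<in> I"
      using I_cancel[of "int k + 1" "int m - int k"] k \<open>0 \<le> e\<close> Suc.prems(1) by simp
  qed (use Suc.prems in auto)
  then show ?case by simp
qed

text \<open>Modulo \<open>I\<close>, \<open>w\<close> is a highest weight vector of weight
  \<open>m\<close>. So \<open>E\<close> sends its image under \<open>k + 1\<close> factors
  \<open>F\<close> to \<open>(k + 1) * (m - k)\<close> times the image under \<open>k\<close>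
  factors. For \<open>k < m\<close> this scalar is a unit, and every lowering step can be
  undone.\<close>

lemma Epow_Fpow_cancel:
  assumes "2 * e + int m = t" "0 \<le> e" "w \<in> V (t - e)" "E w \<in> I" "k \<le> m"
  shows "\<exists>c. w - of_int c * (E ^^ k) ((F ^^ k) w) \<in> I"
  using assms(5)
proof (induction k)
  case 0
  have "w - of_int 1 * (E ^^ 0) ((F ^^ 0) w) \<in> I"
    by (simp add: I_zero)
  then show ?case by blast
next
  case (Suc k)
  interpret swapped: sl2_pair "\<lambda>e. V (t - e)" I F E t
    by (rule swap)
  obtain c where c: "w - of_int c * (E ^^ k) ((F ^^ k) w) \<in> I"
    using Suc by auto
  obtain b where b: "of_int b * of_int ((int k + 1) * (int m - int k)) = (1::'a)"
    by (rule invertible2[of "int k + 1" "int m - int k"]) (use Suc.prems assms(1,2) in auto)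
  let ?y = "(F ^^ k) w" and ?z = "(F ^^ Suc k) w"
  have coeff: "(int k + 1) * (2 * e - t + int k) = - ((int k + 1) * (int m - int k))"
    by (simp add: algebra_simps flip: assms(1))
  have "E ?z = (F ^^ Suc k) (E w) + of_int ((int k + 1) * (int m - int k)) * ?y"
    \<comment> \<open>In the swapped pair \<open>w\<close> sits in degree \<open>e\<close>, so
      \<open>F_Epow\<close> moves \<open>E\<close> past the powers of \<open>F\<close>.\<close>
    unfolding swapped.F_Epow[OF assms(3)] coeff of_int_minus by simp
  then have "of_int b * E ?z =
      of_int b * (F ^^ Suc k) (E w) + of_int b * of_int ((int k + 1) * (int m - int k)) * ?y"
    by (simp only: distrib_left mult.assoc)
  then have *: "?y - of_int b * E ?z = - (of_int b * (F ^^ Suc k) (E w))"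
    by (simp only: b) simp
  have "?y - of_int b * E ?z \<in> I"
    unfolding * by (intro I_minus I_of_int swapped.Epow_I assms(4))
  then have "of_int c * (E ^^ k) (?y - of_int b * E ?z) \<in> I"
    by (intro I_of_int Epow_I)
  moreover have "(E ^^ k) (of_int b * E ?z) = of_int b * (E ^^ Suc k) ?z"
    by (simp only: Epow_of_int funpow_Suc_right comp_apply)
  ultimately have "of_int c * (E ^^ k) ?y - of_int (c * b) * (E ^^ Suc k) ?z \<in> I"
    by (simp only: Epow_diff right_diff_distrib of_int_mult mult.assoc)
  from I_add[OF c this] show ?case by (intro exI[of _ "c * b"]) simp
qed

text \<open>
  By induction on \<open>e\<close> one may subtract an element of the image of \<open>E\<^sup>m\<^sup>+\<^sup>1\<close>
  from \<open>w\<close> to make it a highest weight vector. This replaces a dimension count.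
\<close>

lemma Epow_surj:
  assumes "2 * e + int m = t" "w \<in> V (t - e)"
  shows "\<exists>u\<in>V e. w - (E ^^ m) u \<in> I"
  using assms
proof (induction "nat (e + 1)" arbitrary: e m w)
  case 0
  then have "w - (E ^^ m) 0 \<in> I"
    using V_outside[of "t - e"] Epow_I[OF I_zero] I_diff by auto
  then show ?case using V_zero by blast
next
  case (Suc a)
  interpret swapped: sl2_pair "\<lambda>e. V (t - e)" I F E t
    by (rule swap)
  have "0 \<le> e"
    using Suc.hyps(2) by linarith
  have "E w \<in> V (t - (e - 1))"
    using E_V[OF Suc.prems(2)] by (simp add: algebra_simps)
  moreover have "a = nat (e - 1 + 1)" "2 * (e - 1) + int (Suc (Suc m)) = t"
    using Suc.hyps(2) Suc.prems(1) by auto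
  \<comment> \<open>The hypothesis for \<open>e - 1\<close> and \<open>m + 2\<close> is applied to
    \<open>E w\<close>, so that subtracting \<open>m + 1\<close> factors \<open>E\<close> applied to
    \<open>u\<close> leaves a \<open>w'\<close> killed by \<open>E\<close> modulo
    \<open>I\<close>.\<close>
  ultimately obtain u where u: "u \<in> V (e - 1)" "E w - (E ^^ Suc (Suc m)) u \<in> I"
    using Suc.hyps(1) by blast
  define w' where "w' = w - (E ^^ Suc m) u"
  have "e - 1 + int (Suc m) = t - e"
    using Suc.prems(1) by simp
  then have w': "w' \<in> V (t - e)"
    unfolding w'_def using V_diff[OF Suc.prems(2)] Epow_V[OF u(1), of "Suc m"] by metis
  have "E w' \<in> I"
    using u(2) by (simp add: w'_def E_diff)
  then obtain c where c: "w' - of_int c * (E ^^ m) ((F ^^ m) w') \<in> I"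
    using Epow_Fpow_cancel[OF Suc.prems(1) \<open>0 \<le> e\<close> w'] by blast
  \<comment> \<open>The first summand restores what was subtracted from \<open>w\<close>, the second
    is a preimage of the highest weight part \<open>w'\<close>.\<close>
  define v where "v = E u + of_int c * (F ^^ m) w'"
  have "t - (e + int m) = e"
    using Suc.prems(1) by simp
  then have "(F ^^ m) w' \<in> V e"
    using swapped.Epow_V[OF w', of m] by metis
  moreover have "E u \<in> V e"
    using E_V[OF u(1)] by simp
  ultimately have "v \<in> V e"
    unfolding v_def by (intro V_add V_of_int)
  moreover have "w - (E ^^ m) v = w' - of_int c * (E ^^ m) ((F ^^ m) w')"
    unfolding v_def w'_def
    by (simp only: Epow_add Epow_of_int funpow_Suc_right comp_apply diff_diff_eq)
  ultimately show ?case using c by metis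
qed

text \<open>Between mirror degrees \<open>e\<close> and \<open>t - e\<close> the power of
  \<open>E\<close> is bijective modulo \<open>I\<close>. Below the middle \<open>E ^^ k\<close> is
  the first factor of such a map, hence injective; above it, the last factor, hence
  surjective.\<close>

theorem maximal_rank:
  "(\<forall>v\<in>V e. (E ^^ k) v \<in> I \<longrightarrow> v \<in> I) \<or>
   (\<forall>w\<in>V (e + int k). \<exists>v\<in>V e. w - (E ^^ k) v \<in> I)"
proof (cases "2 * e + int k \<le> t")
  case True
  define m where "m = nat (t - 2 * e)"
  have m: "2 * e + int m = t" "m = (m - k) + k"
    using True by (auto simp: m_def)
  have "v \<in> I" if "v \<in> V e" "(E ^^ k) v \<in> I" for v
  proof -
    have "(E ^^ m) v = (E ^^ (m - k)) ((E ^^ k) v)"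
      by (metis m(2) comp_apply funpow_add)
    then have "(E ^^ m) v \<in> I"
      using Epow_I[OF that(2)] by metis
    then show ?thesis
      using Epow_inj[OF m(1) that(1)] by blast
  qed
  then show ?thesis by blast
next
  case False
  \<comment> \<open>\<open>e'\<close> is the mirror image of the target degree
    \<open>e + k\<close>.\<close>
  define e' m where "e' = t - e - int k" and "m = nat (t - 2 * e')"
  have m: "2 * e' + int m = t" "m = k + (m - k)" "e' + int (m - k) = e" "t - e' = e + int k"
    using False by (auto simp: m_def e'_def)
  have "\<exists>v\<in>V e. w - (E ^^ k) v \<in> I" if w: "w \<in> V (e + int k)" for w
  proof -
    obtain u where u: "u \<in> V e'" "w - (E ^^ m) u \<in> I"
      using Epow_surj[OF m(1)] w m(4) by auto
    have "(E ^^ m) u = (E ^^ k) ((E ^^ (m - k)) u)"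
      by (metis m(2) comp_apply funpow_add)
    then show ?thesis
      using Epow_V[OF u(1), of "m - k"] u(2) m(3) by metis
  qed
  then show ?thesis by blast
qed

end

section \<open>Polynomials and the monomial ideal\<close>

text \<open>The polynomial ring, its homogeneous components and the ideal are all spans of
  monomials, so they share these closure rules and one induction principle.\<close>

definition supported_on :: "'m set \<Rightarrow> ('m \<Rightarrow>\<^sub>0 'c::zero) set" where
  "supported_on S = {f. Poly_Mapping.keys f \<subseteq> S}"

lemma supported_on_zero [simp]: "0 \<in> supported_on S"
  by (simp add: supported_on_def)

lemma supported_on_single: "m \<in> S \<Longrightarrow> Poly_Mapping.single m c \<in> supported_on S"
  by (simp add: supported_on_def)

lemma supported_on_add:
  "f \<in> supported_on S \<Longrightarrow> g \<in> supported_on S \<Longrightarrow> f + g \<in> supported_on S"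
  unfolding supported_on_def using keys_add[of f g] by blast

lemma supported_on_uminus:
  fixes f :: "'m \<Rightarrow>\<^sub>0 'c::ab_group_add"
  shows "f \<in> supported_on S \<Longrightarrow> - f \<in> supported_on S"
  by (auto simp: supported_on_def in_keys_iff subset_eq)

lemma supported_on_diff:
  fixes f :: "'m \<Rightarrow>\<^sub>0 'c::ab_group_add"
  shows "f \<in> supported_on S \<Longrightarrow> g \<in> supported_on S \<Longrightarrow> f - g \<in> supported_on S"
  using supported_on_add[of f S "- g"] supported_on_uminus[of g S] by simp

lemma supported_on_sum:
  "(\<And>i. i \<in> A \<Longrightarrow> f i \<in> supported_on S) \<Longrightarrow> sum f A \<in> supported_on S"
  by (induction A rule: infinite_finite_induct) (simp_all add: supported_on_add)

lemma supported_on_mult: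
  assumes "f \<in> supported_on S" "g \<in> supported_on T"
    and "\<And>a b. a \<in> S \<Longrightarrow> b \<in> T \<Longrightarrow> a + b \<in> U"
  shows "f * g \<in> supported_on U"
  using assms keys_mult[of f g] unfolding supported_on_def by blast

lemma supported_on_induct [consumes 1, case_names zero single add]:
  fixes f :: "'m \<Rightarrow>\<^sub>0 'c::comm_monoid_add"
  assumes "f \<in> supported_on S"
    and "Q 0"
    and "\<And>m c. m \<in> S \<Longrightarrow> Q (Poly_Mapping.single m c)"
    and "\<And>f g. Q f \<Longrightarrow> Q g \<Longrightarrow> Q (f + g)"
  shows "Q f"
proof -
  have "f = (\<Sum>m\<in>Poly_Mapping.keys f. Poly_Mapping.single m (Poly_Mapping.lookup f m))"
    by (rule poly_mapping_eqI)
      (auto simp: lookup_sum lookup_single when_def in_keys_iff sum.delta)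
  moreover have "Q (\<Sum>m\<in>A. Poly_Mapping.single m (Poly_Mapping.lookup f m))"
    if "finite A" "A \<subseteq> S" for A
    using that by (induction A) (auto intro: assms)
  ultimately show ?thesis
    using assms(1) by (metis finite_keys mem_Collect_eq supported_on_def)
qed

lemma CHAR_poly_mapping:
  "CHAR('m::monoid_add \<Rightarrow>\<^sub>0 'c::semiring_1) = CHAR('c)"
proof (rule CHAR_eqI)
  show "of_nat CHAR('c) = (0 :: 'm \<Rightarrow>\<^sub>0 'c)"
    by (subst single_of_nat[symmetric]) simp
next
  fix x
  assume "of_nat x = (0 :: 'm \<Rightarrow>\<^sub>0 'c)"
  then have "of_nat x = (0 :: 'c)"
    by (metis lookup_single_eq lookup_zero single_of_nat)
  then show "CHAR('c) dvd x"
    by (simp add: of_nat_eq_0_iff_char_dvd)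
qed

lemma of_int_mult_single:
  "of_int k * Poly_Mapping.single m (c::'c::ring_1) =
    Poly_Mapping.single (m::'m::monoid_add) (of_int k * c)"
  by (subst single_of_int[symmetric]) (simp only: mult_single add_0)

lemma single_zero_power:
  fixes c :: "'c::comm_semiring_1"
  shows "Poly_Mapping.single (0::'m::comm_monoid_add) c ^ k = Poly_Mapping.single 0 (c ^ k)"
  by (induction k) (simp_all add: mult_single)

lemma variable_poly_power:
  "(variable_poly i :: 'k::field mpoly) ^ k = Poly_Mapping.single (Poly_Mapping.single i k) 1"
  by (induction k)
    (simp_all add: variable_poly_def mult_single flip: single_add)

lemma mon_degree_add: "mon_degree (a + b) = mon_degree a + mon_degree b"
  unfolding mon_degree_def by (rule setsum_keys_plus_distrib) simp_all

lemma mon_degree_single [simp]: "mon_degree (Poly_Mapping.single i k) = k"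
  by (simp add: mon_degree_def)

lemma mon_degree_eq_sum:
  "Poly_Mapping.keys m \<subseteq> {..n} \<Longrightarrow> mon_degree m = (\<Sum>i\<le>n. Poly_Mapping.lookup m i)"
  unfolding mon_degree_def by (rule sum.mono_neutral_left) (auto simp: in_keys_iff)

section \<open>Exponent vectors in \<open>n + 1\<close> variables\<close>

definition exponents :: "nat \<Rightarrow> (nat \<Rightarrow>\<^sub>0 nat) set" where
  "exponents n = {m. Poly_Mapping.keys m \<subseteq> {..n}}"

lemma zero_in_exponents [simp]: "0 \<in> exponents n"
  by (simp add: exponents_def)

lemma single_in_exponents: "i \<le> n \<Longrightarrow> Poly_Mapping.single i k \<in> exponents n"
  by (simp add: exponents_def)

lemma exponents_add: "a \<in> exponents n \<Longrightarrow> b \<in> exponents n \<Longrightarrow> a + b \<in> exponents n"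
  unfolding exponents_def using keys_add[of a b] by blast

lemma exponents_diff: "a \<in> exponents n \<Longrightarrow> a - b \<in> exponents n"
  by (auto simp: exponents_def in_keys_iff lookup_minus subset_eq)

lemma exponents_degree_one:
  assumes "m \<in> exponents n" "mon_degree m = 1"
  obtains i where "i \<le> n" "m = Poly_Mapping.single i 1"
proof -
  have "(\<Sum>j\<le>n. Poly_Mapping.lookup m j) = Suc 0"
    using assms by (simp add: exponents_def flip: mon_degree_eq_sum)
  then obtain i where i: "i \<le> n" "Poly_Mapping.lookup m i = 1"
    "\<forall>j\<le>n. i \<noteq> j \<longrightarrow> Poly_Mapping.lookup m j = 0"
    by (subst (asm) sum_eq_Suc0_iff) auto
  have "Poly_Mapping.lookup m j = 0" if "n < j" for j
    using assms(1) that by (auto simp: exponents_def in_keys_iff)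
  with i have "m = Poly_Mapping.single i 1"
    by (intro poly_mapping_eqI) (metis lookup_single_eq lookup_single_not_eq not_le)
  with i(1) show thesis by (rule that)
qed

text \<open>Exponents are raised one unit at a time, and below the total bound some exponent still
  has room. This later yields the monomial missed by the multiplication map.\<close>

lemma exists_bounded_exponent:
  assumes "N \<le> (\<Sum>i\<le>n. u i)"
  shows "\<exists>m\<in>exponents n. (\<forall>i\<le>n. Poly_Mapping.lookup m i \<le> u i) \<and> mon_degree m = N"
  using assms
proof (induction N)
  case 0
  show ?case by (intro bexI[of _ 0]) (simp_all add: mon_degree_def)
next
  case (Suc N)
  then obtain m where m: "m \<in> exponents n" "\<forall>i\<le>n. Poly_Mapping.lookup m i \<le> u i"
    "mon_degree m = N"
    by auto
  have "\<exists>i\<le>n. Poly_Mapping.lookup m i < u i"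
  proof (rule ccontr)
    assume "\<not> ?thesis"
    then have "(\<Sum>i\<le>n. u i) \<le> (\<Sum>i\<le>n. Poly_Mapping.lookup m i)"
      by (intro sum_mono) (auto simp: not_less)
    also have "\<dots> = N"
      using m by (simp add: exponents_def flip: mon_degree_eq_sum)
    finally show False using Suc.prems by simp
  qed
  then obtain i where "i \<le> n" "Poly_Mapping.lookup m i < u i"
    by blast
  with m show ?case
    by (intro bexI[of _ "m + Poly_Mapping.single i 1"])
      (auto simp: mon_degree_add lookup_add lookup_single when_def
        intro: exponents_add single_in_exponents)
qed

section \<open>The polynomial ring and its grading\<close>

lemma carrier_poly_ring: "carrier (poly_ring n) = supported_on (exponents n)"
  by (auto simp: poly_ring_def supported_on_def exponents_def)

lemma poly_ring_simps [simp]: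
  "mult (poly_ring n) = (*)" "one (poly_ring n) = 1"
  "zero (poly_ring n) = 0" "add (poly_ring n) = (+)"
  by (simp_all add: poly_ring_def)

lemma poly_component_eq:
  "poly_component n e = supported_on {m \<in> exponents n. int (mon_degree m) = e}"
  by (auto simp: poly_component_def carrier_poly_ring supported_on_def)

lemma poly_component_carrier: "poly_component n e \<subseteq> carrier (poly_ring n)"
  by (auto simp: poly_component_def)

lemma poly_component_mult:
  "f \<in> poly_component n a \<Longrightarrow> g \<in> poly_component n b \<Longrightarrow> f * g \<in> poly_component n (a + b)"
  unfolding poly_component_eq
  by (erule supported_on_mult) (auto simp: mon_degree_add exponents_add)

lemma poly_component_one: "1 \<in> poly_component n 0"
  unfolding poly_component_eq
  by (simp add: supported_on_def mon_degree_def)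

lemma poly_component_power:
  "l \<in> poly_component n 1 \<Longrightarrow> l ^ k \<in> poly_component n (int k)"
proof (induction k)
  case (Suc k)
  then show ?case
    using poly_component_mult[of l n 1 "l ^ k" "int k"] by (simp add: algebra_simps)
qed (simp add: poly_component_one)

lemma cring_poly_ring: "cring (poly_ring n :: 'k::field mpoly ring)"
proof (rule cringI)
  show "abelian_group (poly_ring n :: 'k mpoly ring)"
  proof (rule abelian_groupI)
    fix f :: "'k mpoly"
    assume "f \<in> carrier (poly_ring n)"
    then show "\<exists>g\<in>carrier (poly_ring n). g \<oplus>\<^bsub>poly_ring n\<^esub> f = \<zero>\<^bsub>poly_ring n\<^esub>"
      by (intro bexI[of _ "- f"]) (simp_all add: carrier_poly_ring supported_on_uminus)
  qed (simp_all add: carrier_poly_ring supported_on_add add_ac)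
  show "comm_monoid (poly_ring n :: 'k mpoly ring)"
  proof (rule comm_monoidI)
    fix f g :: "'k mpoly"
    assume "f \<in> carrier (poly_ring n)" "g \<in> carrier (poly_ring n)"
    then show "f \<otimes>\<^bsub>poly_ring n\<^esub> g \<in> carrier (poly_ring n)"
      by (auto simp: carrier_poly_ring intro: supported_on_mult exponents_add)
  next
    show "\<one>\<^bsub>poly_ring n\<^esub> \<in> carrier (poly_ring n :: 'k mpoly ring)"
      by (simp add: carrier_poly_ring supported_on_def)
  qed (simp_all add: mult_ac)
qed (simp add: algebra_simps)

lemma poly_ring_nat_pow: "f [^]\<^bsub>poly_ring n\<^esub> (k::nat) = f ^ k"
  by (induction k) (simp_all add: nat_pow_def mult.commute)

lemma poly_ring_minus:
  assumes "g \<in> carrier (poly_ring n)"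
  shows "f \<ominus>\<^bsub>poly_ring n\<^esub> g = f - g"
proof -
  interpret cring "poly_ring n :: 'k::field mpoly ring"
    by (rule cring_poly_ring)
  have "\<ominus>\<^bsub>poly_ring n\<^esub> g = - g"
    using assms by (intro minus_equality) (simp_all add: carrier_poly_ring supported_on_uminus)
  then show ?thesis by (simp add: a_minus_def)
qed

section \<open>The ideal as a span of monomials\<close>

definition big_exponents :: "nat \<Rightarrow> (nat \<Rightarrow> nat) \<Rightarrow> (nat \<Rightarrow>\<^sub>0 nat) set" where
  "big_exponents n d = {m \<in> exponents n. \<exists>i\<le>n. d i \<le> Poly_Mapping.lookup m i}"

lemma big_exponents_add:
  "a \<in> exponents n \<Longrightarrow> b \<in> big_exponents n d \<Longrightarrow> a + b \<in> big_exponents n d"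
  by (auto simp: big_exponents_def exponents_add lookup_add intro: trans_le_add2)

lemma ideal_supported_on_big_exponents:
  "ideal (supported_on (big_exponents n d)) (poly_ring n :: 'k::field mpoly ring)"
proof (rule idealI)
  interpret cring "poly_ring n :: 'k mpoly ring"
    by (rule cring_poly_ring)
  show "ring (poly_ring n :: 'k mpoly ring)"
    by (rule ring_axioms)
  let ?I = "supported_on (big_exponents n d) :: 'k mpoly set"
  have sub: "?I \<subseteq> carrier (poly_ring n)"
    by (auto simp: carrier_poly_ring supported_on_def big_exponents_def)
  show "subgroup ?I (add_monoid (poly_ring n))"
  proof
    fix f
    assume f: "f \<in> ?I"
    have "\<ominus>\<^bsub>poly_ring n\<^esub> f = - f"
      using sub f
      by (intro minus_equality) (auto simp: carrier_poly_ring intro: supported_on_uminus)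
    then show "inv\<^bsub>add_monoid (poly_ring n)\<^esub> f \<in> ?I"
      using f by (simp add: a_inv_def supported_on_uminus)
  qed (use sub in \<open>auto simp: supported_on_add\<close>)
  fix f g :: "'k mpoly"
  assume f: "f \<in> ?I" and g: "g \<in> carrier (poly_ring n)"
  show "g \<otimes>\<^bsub>poly_ring n\<^esub> f \<in> ?I"
    using supported_on_mult[OF g[unfolded carrier_poly_ring] f big_exponents_add] by simp
  then show "f \<otimes>\<^bsub>poly_ring n\<^esub> g \<in> ?I"
    by (simp add: mult.commute)
qed

text \<open>The monomials divisible by some \<open>x_i ^ d i\<close> span an ideal containing the
  generators, and each of them is a multiple of a generator. Membership in the ideal thus becomes a
  condition on \<open>keys\<close>.\<close>

lemma power_ideal_eq:
  "power_ideal n d = (supported_on (big_exponents n d) :: 'k::field mpoly set)"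
proof
  interpret cring "poly_ring n :: 'k mpoly ring"
    by (rule cring_poly_ring)
  let ?G = "{variable_poly i [^]\<^bsub>poly_ring n\<^esub> d i | i. i \<le> n} :: 'k mpoly set"
  have G: "?G \<subseteq> supported_on (big_exponents n d)"
    by (auto simp: poly_ring_nat_pow variable_poly_power big_exponents_def
        single_in_exponents intro!: supported_on_single)
  show "power_ideal n d \<subseteq> (supported_on (big_exponents n d) :: 'k mpoly set)"
    unfolding power_ideal_def
    by (rule genideal_minimal[OF ideal_supported_on_big_exponents G])
  have "?G \<subseteq> carrier (poly_ring n)"
    by (auto simp: poly_ring_nat_pow variable_poly_power carrier_poly_ring
        intro!: supported_on_single single_in_exponents)
  note sub = genideal_self[OF this, folded power_ideal_def]
  interpret J: ideal "power_ideal n d :: 'k mpoly set" "poly_ring n"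
    unfolding power_ideal_def by (rule genideal_ideal[OF \<open>?G \<subseteq> carrier (poly_ring n)\<close>])
  show "supported_on (big_exponents n d) \<subseteq> (power_ideal n d :: 'k mpoly set)"
  proof
    fix f :: "'k mpoly"
    assume "f \<in> supported_on (big_exponents n d)"
    then show "f \<in> power_ideal n d"
    proof (induction rule: supported_on_induct)
      case zero
      show ?case using J.zero_closed by simp
    next
      case (single m c)
      then obtain i where i: "m \<in> exponents n" "i \<le> n" "d i \<le> Poly_Mapping.lookup m i"
        by (auto simp: big_exponents_def)
      have "m - Poly_Mapping.single i (d i) + Poly_Mapping.single i (d i) = m"
        using i(3) by (intro poly_mapping_eqI)
          (auto simp: lookup_add lookup_minus lookup_single when_def)
      then have "Poly_Mapping.single m c =
          Poly_Mapping.single (m - Poly_Mapping.single i (d i)) c * variable_poly i ^ d i"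
        by (simp add: variable_poly_power mult_single)
      moreover have "variable_poly i ^ d i \<in> (power_ideal n d :: 'k mpoly set)"
        using sub i(2) by (auto simp: poly_ring_nat_pow)
      moreover have "Poly_Mapping.single (m - Poly_Mapping.single i (d i)) c
          \<in> carrier (poly_ring n)"
        using i(1) by (simp add: carrier_poly_ring supported_on_single exponents_diff)
      ultimately show ?case
        using J.I_l_closed by simp
    next
      case (add f g)
      then show ?case using J.a_closed by simp
    qed
  qed
qed

section \<open>The lowering operator\<close>

text \<open>
  \<open>weight d i j\<close> is the coefficient in
  \<open>((d\<^sub>i - 1) \<partial>\<^sub>i - x\<^sub>i \<partial>\<^sub>i\<^sup>2) x\<^sub>i\<^sup>j = j (d\<^sub>i - j) x\<^sub>i\<^sup>j\<^sup>-\<^sup>1\<close>.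
  It vanishes for \<open>j = 0\<close>, which makes the truncated subtraction of exponents harmless, and
  for \<open>j = d i\<close>, so that \<open>lowering\<close> preserves the ideal.
\<close>

definition weight :: "(nat \<Rightarrow> nat) \<Rightarrow> nat \<Rightarrow> nat \<Rightarrow> int" where
  "weight d i j = int j * (int (d i) - int j)"

definition lowering :: "nat \<Rightarrow> (nat \<Rightarrow> nat) \<Rightarrow> 'k::field mpoly \<Rightarrow> 'k mpoly" where
  "lowering n d f = (\<Sum>m\<in>Poly_Mapping.keys f. \<Sum>i\<le>n.
    Poly_Mapping.single (m - Poly_Mapping.single i 1)
      (of_int (weight d i (Poly_Mapping.lookup m i)) * Poly_Mapping.lookup f m))"

lemma lowering_zero [simp]: "lowering n d 0 = 0"
  by (simp add: lowering_def)

lemma lowering_add: "lowering n d (f + g) = lowering n d f + lowering n d g"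
  unfolding lowering_def
  by (rule setsum_keys_plus_distrib) (simp_all add: single_add distrib_left sum.distrib)

lemma lowering_diff: "lowering n d (f - g) = lowering n d f - lowering n d g"
  using lowering_add[of n d "f - g" g] by simp

lemma lowering_sum: "lowering n d (sum f A) = (\<Sum>i\<in>A. lowering n d (f i))"
  by (induction A rule: infinite_finite_induct) (simp_all add: lowering_add)

lemma lowering_single:
  "lowering n d (Poly_Mapping.single m c) =
    (\<Sum>i\<le>n. Poly_Mapping.single (m - Poly_Mapping.single i 1)
      (of_int (weight d i (Poly_Mapping.lookup m i)) * c))"
  by (simp add: lowering_def)

lemma lowering_in_component:
  assumes "f \<in> poly_component n e"
  shows "lowering n d f \<in> poly_component n (e - 1)"
  using assms unfolding poly_component_eq
proof (induction rule: supported_on_induct)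
  case (single m c)
  show ?case
    unfolding lowering_single
  proof (rule supported_on_sum)
    fix i
    assume "i \<in> {..n}"
    show "Poly_Mapping.single (m - Poly_Mapping.single i 1)
        (of_int (weight d i (Poly_Mapping.lookup m i)) * c)
      \<in> supported_on {m \<in> exponents n. int (mon_degree m) = e - 1}"
    proof (cases "Poly_Mapping.lookup m i = 0")
      case True
      then show ?thesis by (simp add: weight_def)
    next
      case False
      then have "m - Poly_Mapping.single i 1 + Poly_Mapping.single i 1 = m"
        by (intro poly_mapping_eqI)
          (auto simp: lookup_add lookup_minus lookup_single when_def)
      then have "mon_degree m = mon_degree (m - Poly_Mapping.single i 1) + 1"
        by (metis mon_degree_add mon_degree_single)
      then show ?thesis
        using single by (intro supported_on_single) (auto simp: exponents_diff)
    qed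
  qed
qed (simp_all add: lowering_add supported_on_add)

lemma lowering_in_ideal:
  assumes "f \<in> supported_on (big_exponents n d)"
  shows "lowering n d f \<in> supported_on (big_exponents n d)"
  using assms
proof (induction rule: supported_on_induct)
  case (single m c)
  then obtain j where j: "m \<in> exponents n" "j \<le> n" "d j \<le> Poly_Mapping.lookup m j"
    by (auto simp: big_exponents_def)
  show ?case
    unfolding lowering_single
  proof (rule supported_on_sum)
    fix i
    assume "i \<in> {..n}"
    show "Poly_Mapping.single (m - Poly_Mapping.single i 1)
        (of_int (weight d i (Poly_Mapping.lookup m i)) * c)
      \<in> supported_on (big_exponents n d)"
    \<comment> \<open>Lowering \<open>x_i\<close> leaves the exponent of \<open>x_j\<close> at least
      \<open>d j\<close>, except when \<open>i = j\<close> and this exponent equals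
      \<open>d j\<close>; there the weight vanishes.\<close>
    proof (cases "i = j \<and> d j = Poly_Mapping.lookup m j")
      case True
      then show ?thesis by (simp add: weight_def)
    next
      case False
      then have "d j \<le> Poly_Mapping.lookup (m - Poly_Mapping.single i 1) j"
        using j(3) by (auto simp: lookup_minus lookup_single when_def)
      then show ?thesis
        using j by (intro supported_on_single) (auto simp: big_exponents_def exponents_diff)
    qed
  qed
qed (simp_all add: lowering_add supported_on_add)

definition variable_sum :: "nat \<Rightarrow> 'k::field mpoly" where
  "variable_sum n = (\<Sum>i\<le>n. variable_poly i)"

lemma variable_sum_component: "variable_sum n \<in> poly_component n 1"
  unfolding variable_sum_def poly_component_eq variable_poly_def
  by (intro supported_on_sum supported_on_single) (simp add: single_in_exponents)

lemma variable_sum_mult_single: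
  "variable_sum n * Poly_Mapping.single m c =
    (\<Sum>j\<le>n. Poly_Mapping.single (Poly_Mapping.single j 1 + m) c)"
  by (simp add: variable_sum_def variable_poly_def sum_distrib_right mult_single)

text \<open>Raising \<open>x_j\<close> and lowering \<open>x_i\<close> commute for distinct
  \<open>i\<close> and \<open>j\<close>, so only diagonal terms survive. An exponent
  \<open>a\<close> of \<open>x_i\<close> contributes
  \<open>a (d i - a) - (a + 1) (d i - a - 1) = 2 a + 1 - d i\<close>, and these sum to the
  weight.\<close>

lemma lowering_commutator_single:
  fixes c :: "'k::field"
  assumes "m \<in> exponents n"
  shows "variable_sum n * lowering n d (Poly_Mapping.single m c)
      - lowering n d (variable_sum n * Poly_Mapping.single m c) =
    of_int (2 * int (mon_degree m) - ((\<Sum>i\<le>n. int (d i)) - (int n + 1)))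
      * Poly_Mapping.single m c"
proof -
  let ?x = "\<lambda>i. Poly_Mapping.single i (1::nat)"
  define a where "a i j = (Poly_Mapping.single (?x j + (m - ?x i))
      (of_int (weight d i (Poly_Mapping.lookup m i)) * c))" for i j
  define b where "b i j = (Poly_Mapping.single (?x j + m - ?x i)
      (of_int (weight d i (Poly_Mapping.lookup (?x j + m) i)) * c))" for i j
  have a: "variable_sum n * lowering n d (Poly_Mapping.single m c) = (\<Sum>i\<le>n. \<Sum>j\<le>n. a i j)"
    unfolding lowering_single sum_distrib_left variable_sum_mult_single a_def ..
  have b: "lowering n d (variable_sum n * Poly_Mapping.single m c) = (\<Sum>j\<le>n. \<Sum>i\<le>n. b i j)"
    unfolding lowering_single lowering_sum variable_sum_mult_single b_def ..
  have diff: "a i j - b i j =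
      (if j = i then Poly_Mapping.single m
        (of_int (2 * int (Poly_Mapping.lookup m i) + 1 - int (d i)) * c) else 0)" for i j
  proof (cases "j = i")
    case True
    have "a i i = Poly_Mapping.single m (of_int (weight d i (Poly_Mapping.lookup m i)) * c)"
    proof (cases "Poly_Mapping.lookup m i = 0")
      case True
      then show ?thesis by (simp add: a_def weight_def)
    next
      case False
      then have "?x i + (m - ?x i) = m"
        by (intro poly_mapping_eqI)
          (auto simp: lookup_add lookup_minus lookup_single when_def)
      then show ?thesis by (simp add: a_def)
    qed
    moreover have "b i i =
        Poly_Mapping.single m (of_int (weight d i (Poly_Mapping.lookup m i + 1)) * c)"
      by (simp add: b_def lookup_add)
    moreover have "weight d i (Poly_Mapping.lookup m i) - weight d i (Poly_Mapping.lookup m i + 1) =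
        2 * int (Poly_Mapping.lookup m i) + 1 - int (d i)"
      by (simp add: weight_def algebra_simps)
    ultimately show ?thesis
      using True
      by (simp only: single_diff[symmetric] left_diff_distrib[symmetric] of_int_diff[symmetric]) simp
  next
    case False
    then have lookup: "Poly_Mapping.lookup (?x j + m) i = Poly_Mapping.lookup m i"
      by (simp add: lookup_add lookup_single when_def)
    show ?thesis
    proof (cases "Poly_Mapping.lookup m i = 0")
      case True
      then show ?thesis unfolding a_def b_def lookup using False by (simp add: weight_def)
    next
      case nonzero: False
      then have "?x j + (m - ?x i) = ?x j + m - ?x i"
        using False by (intro poly_mapping_eqI)
          (auto simp: lookup_add lookup_minus lookup_single when_def)
      then show ?thesis using False unfolding a_def b_def lookup by simp
    qed
  qed
  have degree: "int (mon_degree m) = (\<Sum>i\<le>n. int (Poly_Mapping.lookup m i))"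
    using assms by (simp add: exponents_def mon_degree_eq_sum)
  have "variable_sum n * lowering n d (Poly_Mapping.single m c)
      - lowering n d (variable_sum n * Poly_Mapping.single m c) = (\<Sum>i\<le>n. \<Sum>j\<le>n. a i j - b i j)"
    unfolding a b by (subst sum.swap[of "\<lambda>j i. b i j"]) (simp add: sum_subtractf)
  also have "\<dots> = (\<Sum>i\<le>n. Poly_Mapping.single m
      (of_int (2 * int (Poly_Mapping.lookup m i) + 1 - int (d i)) * c))"
    unfolding diff by (simp add: sum.delta)
  also have "\<dots> = of_int (\<Sum>i\<le>n. 2 * int (Poly_Mapping.lookup m i) + 1 - int (d i))
      * Poly_Mapping.single m c"
    by (simp only: of_int_mult_single[symmetric] of_int_sum sum_distrib_right)
  also have "(\<Sum>i\<le>n. 2 * int (Poly_Mapping.lookup m i) + 1 - int (d i)) =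
      2 * int (mon_degree m) - ((\<Sum>i\<le>n. int (d i)) - (int n + 1))"
    unfolding degree by (simp add: sum.distrib sum_subtractf sum_distrib_left)
  finally show ?thesis .
qed

lemma lowering_commutator:
  assumes "f \<in> poly_component n e"
  shows "variable_sum n * lowering n d f - lowering n d (variable_sum n * f) =
    of_int (2 * e - ((\<Sum>i\<le>n. int (d i)) - (int n + 1))) * f"
  using assms unfolding poly_component_eq
proof (induction rule: supported_on_induct)
  case (single m c)
  then show ?case using lowering_commutator_single[of m n d c] by simp
next
  case (add f g)
  then show ?case by (simp only: distrib_left lowering_add) (simp add: algebra_simps)
qed simp

text \<open>A monomial outside the ideal has each exponent at most \<open>d i - 1\<close>, hence
  degree at most the socle degree.\<close>

lemma poly_component_subset_ideal:
  assumes "e < 0 \<or> (\<Sum>i\<le>n. int (d i)) - (int n + 1) < e"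
  shows "poly_component n e \<subseteq> supported_on (big_exponents n d)"
proof -
  have "m \<in> big_exponents n d" if m: "m \<in> exponents n" "int (mon_degree m) = e" for m
  proof (rule ccontr)
    assume "m \<notin> big_exponents n d"
    then have "Poly_Mapping.lookup m i < d i" if "i \<le> n" for i
      using m(1) that not_le unfolding big_exponents_def by blast
    then have "int (Poly_Mapping.lookup m i) \<le> int (d i) - 1" if "i \<le> n" for i
      using that by force
    then have "(\<Sum>i\<le>n. int (Poly_Mapping.lookup m i)) \<le> (\<Sum>i\<le>n. int (d i) - 1)"
      by (intro sum_mono) simp
    also have "\<dots> = (\<Sum>i\<le>n. int (d i)) - (int n + 1)"
      by (simp add: sum_subtractf)
    finally have "int (mon_degree m) \<le> (\<Sum>i\<le>n. int (d i)) - (int n + 1)"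
      using m(1) by (simp add: exponents_def mon_degree_eq_sum)
    with m(2) assms show False by linarith
  qed
  then show ?thesis
    by (auto simp: poly_component_eq supported_on_def)
qed

lemma power_ideal_maximal_rank:
  fixes p :: nat and d :: "nat \<Rightarrow> nat"
  assumes "prime p" "CHAR('k::field) = p" "(\<Sum>i\<le>n. int (d i)) - (int n + 1) < int p"
  defines "J \<equiv> supported_on (big_exponents n d) :: 'k mpoly set"
  shows "(\<forall>v\<in>poly_component n e. variable_sum n ^ k * v \<in> J \<longrightarrow> v \<in> J) \<or>
    (\<forall>w\<in>poly_component n (e + int k). \<exists>v\<in>poly_component n e. w - variable_sum n ^ k * v \<in> J)"
proof -
  let ?l = "variable_sum n :: 'k mpoly"
  let ?t = "(\<Sum>i\<le>n. int (d i)) - (int n + 1)"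
  interpret sl2_pair "poly_component n" J "(*) ?l" "lowering n d" ?t
  proof
    fix c :: int
    assume c: "0 < c" "c \<le> ?t"
    \<comment> \<open>A positive \<open>c\<close> below \<open>p\<close> is prime to
      \<open>p\<close>. Bezout then gives an integer inverse, because \<open>p\<close> is zero in
      the polynomial ring.\<close>
    then have "coprime c (int p)"
      using assms(1,3) zdvd_not_zless[of c "int p"]
      by (metis coprime_commute order_le_less_trans prime_imp_coprime prime_nat_int_transfer)
    then obtain a b where "a * c + b * int p = 1"
      using bezout_int[of c "int p"] by auto
    then have "of_int a * of_int c + of_int b * of_nat p = (1 :: 'k mpoly)"
      by (metis of_int_1 of_int_add of_int_mult of_int_of_nat_eq)
    moreover have "of_nat p = (0 :: 'k mpoly)"
      by (metis CHAR_poly_mapping assms(2) of_nat_CHAR)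
    ultimately show "\<exists>b. of_int b * of_int c = (1 :: 'k mpoly)"
      by auto
  next
    fix f :: "'k mpoly" and e
    assume f: "f \<in> poly_component n e"
    show "?l * f \<in> poly_component n (e + 1)"
      using poly_component_mult[OF variable_sum_component f] by (simp add: add.commute)
    show "lowering n d f \<in> poly_component n (e - 1)"
      by (rule lowering_in_component[OF f])
    show "?l * lowering n d f - lowering n d (?l * f) = of_int (2 * e - ?t) * f"
      by (rule lowering_commutator[OF f])
  next
    fix f :: "'k mpoly"
    assume "f \<in> J"
    then show "?l * f \<in> J" "lowering n d f \<in> J"
      unfolding J_def
      using variable_sum_component[of n] poly_component_carrier
      by (auto simp: carrier_poly_ring intro: lowering_in_ideal
          intro!: supported_on_mult[OF _ _ big_exponents_add])
  qed (use poly_component_subset_ideal in \<open>auto simp: J_def poly_component_eq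
      supported_on_diff lowering_diff algebra_simps\<close>)
  have "((*) ?l ^^ k) f = ?l ^ k * f" for f k
    by (induction k) (simp_all add: mult.assoc)
  then show ?thesis
    using maximal_rank[of e k] by simp
qed

section \<open>The strong Lefschetz property of the quotient\<close>

text \<open>Maximal rank is pulled back to representatives: by additivity injectivity is a condition
  on the kernel, and surjectivity is solvability modulo \<open>J\<close>.\<close>

lemma strong_lefschetz_property_quotient_iff:
  fixes J :: "'k::field mpoly set"
  assumes "ideal J (poly_ring n)"
  shows "strong_lefschetz_property (poly_ring n Quot J) (quotient_component n J) \<longleftrightarrow>
    (\<exists>l\<in>poly_component n 1. \<forall>e. \<forall>k\<ge>1.
      (\<forall>v\<in>poly_component n e. l ^ k * v \<in> J \<longrightarrow> v \<in> J) \<or>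
      (\<forall>w\<in>poly_component n (e + int k). \<exists>v\<in>poly_component n e. w - l ^ k * v \<in> J))"
proof -
  interpret ideal J "poly_ring n"
    by fact
  let ?q = "a_r_coset (poly_ring n) J"
  have coset_eq: "?q f = ?q g \<longleftrightarrow> f - g \<in> J"
    if "f \<in> carrier (poly_ring n)" "g \<in> carrier (poly_ring n)" for f g
    using quotient_eq_iff_same_a_r_cos[OF assms that] poly_ring_minus[OF that(2)] by metis
  have carr: "f \<in> carrier (poly_ring n)" if "f \<in> poly_component n e" for f :: "'k mpoly" and e
    using that poly_component_carrier by blast
  have mult: "?q f \<otimes>\<^bsub>poly_ring n Quot J\<^esub> ?q g = ?q (f * g)"
    if "f \<in> carrier (poly_ring n)" "g \<in> carrier (poly_ring n)" for f g
    using rcoset_mult_add[OF that] by (simp add: FactRing_def)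
  have comp: "l ^ k * v \<in> poly_component n (e + int k)"
    if "l \<in> poly_component n 1" "v \<in> poly_component n e" for l v :: "'k mpoly" and e k
    using poly_component_mult[OF poly_component_power[OF that(1)] that(2)]
    by (simp add: add.commute)
  have power: "?q l [^]\<^bsub>poly_ring n Quot J\<^esub> k = ?q (l ^ k)"
    if l: "l \<in> poly_component n 1" for l and k :: nat
  proof (induction k)
    case (Suc k)
    then show ?case
      using mult[OF carr[OF poly_component_power[OF l]] carr[OF l], of k]
      by (simp add: nat_pow_def mult.commute)
  qed (simp add: nat_pow_def FactRing_def)
  have mul: "?q l [^]\<^bsub>poly_ring n Quot J\<^esub> k \<otimes>\<^bsub>poly_ring n Quot J\<^esub> ?q v = ?q (l ^ k * v)"
    if "l \<in> poly_component n 1" "v \<in> poly_component n e" for l v and e :: int and k :: nat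
    unfolding power[OF that(1)]
    by (rule mult[OF carr[OF poly_component_power[OF that(1)]] carr[OF that(2)]])
  have zero: "0 \<in> poly_component n e" for e
    by (simp add: poly_component_eq)
  have diff: "u - v \<in> poly_component n e"
    if "u \<in> poly_component n e" "v \<in> poly_component n e" for u v :: "'k mpoly" and e
    using that by (simp add: poly_component_eq supported_on_diff)
  have inj: "inj_on (\<lambda>a. ?q l [^]\<^bsub>poly_ring n Quot J\<^esub> k \<otimes>\<^bsub>poly_ring n Quot J\<^esub> a)
      (quotient_component n J e) \<longleftrightarrow>
      (\<forall>v\<in>poly_component n e. l ^ k * v \<in> J \<longrightarrow> v \<in> J)" (is "?L \<longleftrightarrow> ?R")
    if l: "l \<in> poly_component n 1" for l and e :: int and k :: nat
  proof
    assume L: ?L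
    show ?R
    proof (intro ballI impI)
      fix v
      assume v: "v \<in> poly_component n e" "l ^ k * v \<in> J"
      then have "?q (l ^ k * v) = ?q (l ^ k * 0)"
        using coset_eq[OF carr[OF comp[OF l v(1)]] carr[OF zero]] by simp
      then have "?q v = ?q 0"
        using inj_onD[OF L] v(1) zero mul[OF l v(1)] mul[OF l zero]
        by (metis imageI quotient_component_def)
      then show "v \<in> J"
        using coset_eq[OF carr[OF v(1)] carr[OF zero]] by simp
    qed
  next
    assume R: ?R
    show ?L
      unfolding quotient_component_def
    proof (rule inj_onI, elim imageE, hypsubst)
      fix u v
      assume u: "u \<in> poly_component n e" and v: "v \<in> poly_component n e"
        and "?q l [^]\<^bsub>poly_ring n Quot J\<^esub> k \<otimes>\<^bsub>poly_ring n Quot J\<^esub> ?q u =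
          ?q l [^]\<^bsub>poly_ring n Quot J\<^esub> k \<otimes>\<^bsub>poly_ring n Quot J\<^esub> ?q v"
      then have "l ^ k * u - l ^ k * v \<in> J"
        using coset_eq[OF carr[OF comp[OF l u]] carr[OF comp[OF l v]]]
          mul[OF l u] mul[OF l v] by metis
      then have "u - v \<in> J"
        using R diff[OF u v] by (simp add: right_diff_distrib)
      then show "?q u = ?q v"
        using coset_eq[OF carr[OF u] carr[OF v]] by blast
    qed
  qed
  have surj: "(\<lambda>a. ?q l [^]\<^bsub>poly_ring n Quot J\<^esub> k \<otimes>\<^bsub>poly_ring n Quot J\<^esub> a)
      ` quotient_component n J e = quotient_component n J (e + int k) \<longleftrightarrow>
      (\<forall>w\<in>poly_component n (e + int k). \<exists>v\<in>poly_component n e. w - l ^ k * v \<in> J)"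
    (is "?L = _ \<longleftrightarrow> ?R")
    if l: "l \<in> poly_component n 1" for l and e :: int and k :: nat
  proof -
    have L: "?L = (\<lambda>v. ?q (l ^ k * v)) ` poly_component n e"
      unfolding quotient_component_def image_image using mul[OF l] by auto
    \<comment> \<open>Homogeneity gives this inclusion, so equality of the image with the component
      amounts to the reverse one.\<close>
    have "?L \<subseteq> quotient_component n J (e + int k)"
      unfolding L unfolding quotient_component_def using comp[OF l] by auto
    moreover have "quotient_component n J (e + int k) \<subseteq> ?L \<longleftrightarrow>
        (\<forall>w\<in>poly_component n (e + int k). \<exists>v\<in>poly_component n e. ?q w = ?q (l ^ k * v))"
      unfolding L unfolding quotient_component_def by auto
    moreover have "?q w = ?q (l ^ k * v) \<longleftrightarrow> w - l ^ k * v \<in> J"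
      if "w \<in> poly_component n (e + int k)" "v \<in> poly_component n e" for v w
      using coset_eq[OF carr[OF that(1)] carr[OF comp[OF l that(2)]]] .
    ultimately show ?thesis by auto
  qed
  show ?thesis
    unfolding strong_lefschetz_property_def
    using inj surj by (auto simp: quotient_component_def[of n J 1])
qed

section \<open>Failure of maximal rank in characteristic \<open>p\<close>\<close>

lemma linear_form_prime_power:
  fixes l :: "'k::field mpoly"
  assumes "l \<in> poly_component n 1" "prime p" "CHAR('k) = p" "q = p ^ s"
  shows "l ^ q \<in> supported_on ((\<lambda>i. Poly_Mapping.single i q) ` {..n})"
  using assms(1) unfolding poly_component_eq
proof (induction rule: supported_on_induct)
  case zero
  then show ?case
    using assms by (simp add: power_0_left prime_gt_0_nat)
next
  case (single m c)
  then obtain i where i: "i \<le> n" "m = Poly_Mapping.single i 1"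
    by (auto elim: exponents_degree_one)
  have "Poly_Mapping.single m c = Poly_Mapping.single 0 c * variable_poly i"
    by (simp add: i variable_poly_def mult_single)
  also have "\<dots> ^ q = Poly_Mapping.single (Poly_Mapping.single i q) (c ^ q)"
    by (simp add: power_mult_distrib variable_poly_power single_zero_power mult_single)
  finally show ?case
    using i(1) by (simp add: supported_on_single)
next
  case (add f g)
  \<comment> \<open>All mixed binomial terms vanish, as \<open>q\<close> is a power of the
    characteristic.\<close>
  have "(f + g) ^ q = f ^ q + g ^ q"
    using assms by (intro freshmans_dream'[where n = s]) (simp_all add: CHAR_poly_mapping)
  then show ?case using add by (simp add: supported_on_add)
qed

text \<open>
  The map \<open>l ^ q\<close> kills \<open>x\<^sub>0\<close> to the power \<open>d 0 - q\<close> (truncated, so this is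
  \<open>1\<close> if \<open>d 0 \<le> q\<close>), and its image misses any monomial outside the ideal in which
  \<open>x\<^sub>0\<close> has exponent less than \<open>q\<close>. The last hypothesis says that such a monomial
  exists in degree \<open>max (d 0) q\<close>.
\<close>

lemma power_ideal_not_strong_lefschetz:
  fixes n p q :: nat and d :: "nat \<Rightarrow> nat"
  assumes "prime p" "CHAR('k::field) = p" "q = p ^ s"
    and "\<And>i. i \<le> n \<Longrightarrow> 0 < d i" "\<And>i. 1 \<le> i \<Longrightarrow> i \<le> n \<Longrightarrow> d i \<le> q"
    and "int (max (d 0) q) \<le> (\<Sum>i\<le>n. int (d i)) - (int n + 1) - int (d 0) + int (min q (d 0))"
  shows "\<not> strong_lefschetz_property (poly_ring n Quot (power_ideal n d :: 'k mpoly set))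
    (quotient_component n (power_ideal n d))"
proof -
  let ?J = "supported_on (big_exponents n d) :: 'k mpoly set"
  have q: "0 < q"
    using assms(1,3) by (simp add: prime_gt_0_nat)
  \<comment> \<open>These are the largest exponents of a monomial outside the ideal with
    \<open>x_0\<close>-exponent below \<open>q\<close>; their sum is the right-hand side of the last
    hypothesis.\<close>
  define u where "u i = (if i = 0 then min q (d 0) - 1 else d i - 1)" for i
  have u: "int (u i) = int (d i) - 1 - (if i = 0 then int (d 0) - int (min q (d 0)) else 0)"
    if "i \<le> n" for i
    using assms(4)[OF that] q by (auto simp: u_def)
  have "int (\<Sum>i\<le>n. u i) =
      (\<Sum>i\<le>n. int (d i) - 1 - (if i = 0 then int (d 0) - int (min q (d 0)) else 0))"
    unfolding of_nat_sum by (rule sum.cong) (auto simp: u)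
  also have "\<dots> = (\<Sum>i\<le>n. int (d i)) - (int n + 1) - int (d 0) + int (min q (d 0))"
    by (simp add: sum_subtractf)
  finally have "max (d 0) q \<le> (\<Sum>i\<le>n. u i)"
    using assms(6) by linarith
  then obtain b where b: "b \<in> exponents n" "\<forall>i\<le>n. Poly_Mapping.lookup b i \<le> u i"
    "mon_degree b = max (d 0) q"
    using exists_bounded_exponent by blast
  have b_small: "Poly_Mapping.lookup b i < min q (d i)" if "i \<le> n" for i
  proof (cases "i = 0")
    case True
    then show ?thesis
      using b(2) that assms(4)[OF that] q by (fastforce simp: u_def)
  next
    case False
    then have "Poly_Mapping.lookup b i < d i"
      using b(2) that assms(4)[OF that] by (fastforce simp: u_def)
    then show ?thesis
      using assms(5)[of i] that False by simp
  qed
  let ?g = "Poly_Mapping.single (Poly_Mapping.single 0 (d 0 - q)) 1 :: 'k mpoly"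
  let ?w = "Poly_Mapping.single b 1 :: 'k mpoly"
  \<comment> \<open>With truncated subtraction, \<open>(d 0 - q) + q\<close> is
    \<open>max (d 0) q\<close>, the degree of \<open>b\<close>.\<close>
  let ?e = "int (d 0 - q)"
  have not_inj: "\<not> (\<forall>v\<in>poly_component n ?e. l ^ q * v \<in> ?J \<longrightarrow> v \<in> ?J)"
    and not_surj: "\<not> (\<forall>w\<in>poly_component n (?e + int q). \<exists>v\<in>poly_component n ?e. w - l ^ q * v \<in> ?J)"
    if l: "l \<in> poly_component n 1" for l
  proof -
    note lq = linear_form_prime_power[OF l assms(1-3)]
    have g: "?g \<in> poly_component n ?e"
      by (simp add: poly_component_eq supported_on_single single_in_exponents)
    have "Poly_Mapping.lookup (Poly_Mapping.single 0 (d 0 - q)) i < d i" if "i \<le> n" for i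
      using assms(4)[OF that] q by (auto simp: lookup_single when_def)
    then have "Poly_Mapping.single 0 (d 0 - q) \<notin> big_exponents n d"
      by (fastforce simp: big_exponents_def)
    then have "?g \<notin> ?J"
      by (simp add: supported_on_def)
    moreover have "l ^ q * ?g \<in> ?J"
    proof (rule supported_on_mult[OF lq supported_on_single[OF singletonI]])
      fix x y :: "nat \<Rightarrow>\<^sub>0 nat"
      assume "x \<in> (\<lambda>i. Poly_Mapping.single i q) ` {..n}" "y \<in> {Poly_Mapping.single 0 (d 0 - q)}"
      then obtain i where i: "i \<le> n" "x = Poly_Mapping.single i q"
        and y: "y = Poly_Mapping.single 0 (d 0 - q)"
        by auto
      \<comment> \<open>For \<open>i = 0\<close> the exponents add up to at least
        \<open>d 0\<close>; for the other variables \<open>q\<close> alone reaches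
        \<open>d i\<close>.\<close>
      have "d i \<le> Poly_Mapping.lookup (x + y) i"
        using assms(5)[of i] i(1) by (cases "i = 0") (simp_all add: i(2) y lookup_add)
      moreover have "x + y \<in> exponents n"
        unfolding i(2) y using i(1) by (intro exponents_add single_in_exponents) simp_all
      ultimately show "x + y \<in> big_exponents n d"
        using i(1) by (auto simp: big_exponents_def)
    qed
    ultimately show "\<not> (\<forall>v\<in>poly_component n ?e. l ^ q * v \<in> ?J \<longrightarrow> v \<in> ?J)"
      using g by blast
    have "?w \<in> poly_component n (?e + int q)"
      using b by (auto simp: poly_component_eq intro!: supported_on_single)
    moreover have "?w - l ^ q * v \<notin> ?J" if "v \<in> poly_component n ?e" for v
    proof -
      \<comment> \<open>Every monomial of the product has some exponent at least \<open>q\<close>,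
        whereas all exponents of \<open>b\<close> are below \<open>q\<close>. The coefficient of
        \<open>b\<close> in the difference therefore stays 1.\<close>
      have "l ^ q * v \<in> supported_on (- {b})"
      proof (rule supported_on_mult[OF lq])
        show "v \<in> supported_on UNIV"
          by (simp add: supported_on_def)
        fix x y
        assume "x \<in> (\<lambda>i. Poly_Mapping.single i q) ` {..n}"
        then obtain i where "i \<le> n" "x = Poly_Mapping.single i q"
          by auto
        then have "Poly_Mapping.lookup (x + y) i \<noteq> Poly_Mapping.lookup b i"
          using b_small[of i] by (auto simp: lookup_add)
        then show "x + y \<in> - {b}" by auto
      qed
      then have "Poly_Mapping.lookup (?w - l ^ q * v) b = 1"
        by (auto simp: supported_on_def lookup_minus in_keys_iff)
      then have "b \<in> Poly_Mapping.keys (?w - l ^ q * v)"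
        by (simp add: in_keys_iff)
      moreover have "b \<notin> big_exponents n d"
        using b_small by (fastforce simp: big_exponents_def)
      ultimately show ?thesis
        by (auto simp: supported_on_def)
    qed
    ultimately show "\<not> (\<forall>w\<in>poly_component n (?e + int q).
        \<exists>v\<in>poly_component n ?e. w - l ^ q * v \<in> ?J)"
      by blast
  qed
  show ?thesis
    unfolding power_ideal_eq
      strong_lefschetz_property_quotient_iff[OF ideal_supported_on_big_exponents]
  proof
    assume "\<exists>l\<in>poly_component n 1. \<forall>e. \<forall>k\<ge>1.
      (\<forall>v\<in>poly_component n e. l ^ k * v \<in> ?J \<longrightarrow> v \<in> ?J) \<or>
      (\<forall>w\<in>poly_component n (e + int k). \<exists>v\<in>poly_component n e. w - l ^ k * v \<in> ?J)"
    then obtain l where l: "l \<in> poly_component n 1"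
      and rank: "\<And>e k. 1 \<le> k \<Longrightarrow>
        (\<forall>v\<in>poly_component n e. l ^ k * v \<in> ?J \<longrightarrow> v \<in> ?J) \<or>
        (\<forall>w\<in>poly_component n (e + int k). \<exists>v\<in>poly_component n e. w - l ^ k * v \<in> ?J)"
      by blast
    have "1 \<le> q" using q by simp
    from rank[OF this, of ?e] not_inj[OF l] not_surj[OF l] show False
      by blast
  qed
qed

theorem theorem3p6:
  fixes n p :: nat and d :: "nat \<Rightarrow> nat" and t :: int
    and I :: "'k::field mpoly set"
  assumes "1 \<le> n"
    and "\<forall>i<n. d (Suc i) \<le> d i"
    and "2 \<le> d n"
    and "t = (\<Sum>i\<le>n. int (d i)) - (int n + 1)"
    and "infinite (UNIV :: 'k set)"
    and "prime p"
    and "CHAR('k) = p"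
    and "I = power_ideal n d"
  shows "((max (int (d 1)) (2 * int (d 0) - t) \<le> int p \<and> int p \<le> int (d 0)) \<or>
          (\<exists>m\<ge>1. d 0 \<le> p ^ m \<and> int (p ^ m) \<le> t)
            \<longrightarrow> \<not> strong_lefschetz_property (poly_ring n Quot I) (quotient_component n I)) \<and>
         (int p > t
            \<longrightarrow> strong_lefschetz_property (poly_ring n Quot I) (quotient_component n I))"
proof (intro conjI impI)
  have mono: "d j \<le> d i" if "i \<le> j" "j \<le> n" for i j
    using that
  proof (induction j rule: dec_induct)
    case (step j)
    then show ?case using assms(2) by (metis Suc_le_eq le_trans less_imp_le)
  qed simp
  have pos: "0 < d i" if "i \<le> n" for i
    using mono[OF that] assms(3) by simp
  \<comment> \<open>One inequality covers both cases of (i): for \<open>p ^ m <= d 0\<close> it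
    reads \<open>2 * d 0 - t <= p ^ m\<close>, and for \<open>d 0 <= p ^ m\<close> it reads
    \<open>p ^ m <= t\<close>.\<close>
  have not_slp: "\<not> strong_lefschetz_property (poly_ring n Quot I) (quotient_component n I)"
    if "d 1 \<le> p ^ m" "int (max (d 0) (p ^ m)) \<le> t - int (d 0) + int (min (p ^ m) (d 0))" for m
    unfolding \<open>I = power_ideal n d\<close>
  proof (rule power_ideal_not_strong_lefschetz[OF assms(6,7) refl pos])
    show "d i \<le> p ^ m" if "1 \<le> i" "i \<le> n" for i
      using mono[OF that] \<open>d 1 \<le> p ^ m\<close> by simp
  qed (use that(2) assms(4) in auto)
  assume "(max (int (d 1)) (2 * int (d 0) - t) \<le> int p \<and> int p \<le> int (d 0)) \<or>
    (\<exists>m\<ge>1. d 0 \<le> p ^ m \<and> int (p ^ m) \<le> t)"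
  then show "\<not> strong_lefschetz_property (poly_ring n Quot I) (quotient_component n I)"
  proof
    assume "max (int (d 1)) (2 * int (d 0) - t) \<le> int p \<and> int p \<le> int (d 0)"
    then have "d 1 \<le> p" "2 * int (d 0) - t \<le> int p" "p \<le> d 0"
      by auto
    then show ?thesis
      by (intro not_slp[of 1]) (simp_all add: max_def min_def)
  next
    assume "\<exists>m\<ge>1. d 0 \<le> p ^ m \<and> int (p ^ m) \<le> t"
    then obtain m where "d 0 \<le> p ^ m" "int (p ^ m) \<le> t"
      by blast
    moreover have "d 1 \<le> d 0"
      using mono[of 0 1] assms(1) by simp
    ultimately show ?thesis
      by (intro not_slp[of m]) (auto simp: max_def min_def)
  qed
next
  assume "t < int p"
  then show "strong_lefschetz_property (poly_ring n Quot I) (quotient_component n I)"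
    \<comment> \<open>The sum of the variables serves as Lefschetz element for all degrees and
      powers at once.\<close>
    unfolding \<open>I = power_ideal n d\<close> power_ideal_eq
      strong_lefschetz_property_quotient_iff[OF ideal_supported_on_big_exponents]
    using power_ideal_maximal_rank[OF assms(6,7)] variable_sum_component assms(4) by blast
qed

end
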